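(* Let $\mathcal C$ be a category, let $\{[N_i,d_i]\}_{i\in I}$ be a center in $\mathcal C$, put $\Sigma=\{d_i\}_{i\in I}$, let $\mathcal C'=\mathcal C\left[\{(d_i)^{-1}\circ N_i\}_{i\in I}\right]$ be the dilatation of $\mathcal C$ with this center, and let $\Theta:\mathcal C\to\mathcal C'$ be the canonical functor. Let $F:\mathcal C\to\mathcal D$ be an object of $Cat_{\mathcal C}^{\Sigma\text{-reg}}$ (i.e. a functor such that the localization functor $\mathcal D\to\mathcal D[F(\Sigma)^{-1}]$ is faithful) such that for every $i\in I$ one has $S^{\mathcal D}_{F(N_i)}\subset S^{\mathcal D}_{F(d_i)}$. Then there is a unique functor $F':\mathcal C'\to\mathcal D$ such that $F=F'\circ\Theta$.
   Context: Sieves. A sieve in a category $\mathcal C$ is a collection of morphisms stable under precomposition; a sieve over an object $Y$ is a sieve all of whose morphisms have codomain $Y$. For a collection $E$ of morphisms of $\mathcal C$, $S^{\mathcal C}_E$ denotes the sieve generated by $E$, i.e. the collection of all $e\circ n$ with $e\in E$, $n\in Mor\,\mathcal C$, $cod(n)=dom(e)$; for a single morphism $d$, $S^{\mathcal C}_d:=S^{\mathcal C}_{\{d\}}$. Localization. For a collection $\Sigma$ of morphisms of $\mathcal C$, let $\mathcal G$ be the directed graph whose vertices are the objects of $\mathcal C$ and whose directed lines are: a line $a:dom(a)\to cod(a)$ for each morphism $a$ of $\mathcal C$, and a line $l_d:cod(d)\to dom(d)$ for each $d\in\Sigma$. A $\Sigma$-sequence is a finite, possibly empty, path of composable directed lines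 of $\mathcal G$ (an empty sequence is given by an object). Two $\Sigma$-sequences with the same domain and codomain are equivalent if they are related by a chain of replacements of consecutive parts (written in order of traversal): $X\xrightarrow{a}Y\xrightarrow{a'}Z \leftrightsquigarrow X\xrightarrow{a'\circ a}Z$ for $a,a'\in Mor\,\mathcal C$; $l_d,d\leftrightsquigarrow$ empty and $d,l_d\leftrightsquigarrow$ empty for $d\in\Sigma$; $Id_X\leftrightsquigarrow$ empty sequence at $X$. The class of $s$ is denoted $[s]$; a $\Sigma$-fraction is such a class. The localization $\mathcal C[\Sigma^{-1}]$ has the objects of $\mathcal C$ as objects and $\Sigma$-fractions as morphisms (composed by concatenation); the localization functor $\mathcal C\to\mathcal C[\Sigma^{-1}]$ is the identity on objects and $a\mapsto[a]$ on morphisms. Dilatation. A center in $\mathcal C$ is a collection $\{[N_i,d_i]\}_{i\in I}$ where each $d_i$ is a morphism of $\mathcal C$ and $N_i$ is a sieve over $cod(d_i)$. Put $\Sigma=\{d_i\}_{i\in I}$. A $\{[N_i,d_i]\}_{i\in I}$-fraction is a $\Sigma$-fraction having a representative of the form $X_1\xrightarrow{n_1}Y_1\xrightarrow{l_{d_{i_1}}}X_2\xrightarrow{n_2}Y_2\xrightarrow{l_{d_{i_2}}}X_3\cdots X_k\xrightarrow{n_k}Y_k\xrightarrow{l_{d_{i_k}}}X_{k+1}\xrightarrow{a}X_{k+2}$ with $a\in Mor\,\mathcal C$, $k\ge 0$, $i_j\in I$ and $n_j\in N_{i_j}$ for all $j$. The dilatation $\mathcal C\left[\{(d_i)^{-1}\circ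 N_i\}_{i\in I}\right]$ is the category with the same objects as $\mathcal C$ and with $\{[N_i,d_i]\}_{i\in I}$-fractions as morphisms (a subcategory of $\mathcal C[\Sigma^{-1}]$). The canonical functor $\Theta$ is the identity on objects and $\Theta(a)=[a]$ on morphisms. $Cat_{\mathcal C}^{\Sigma\text{-reg}}$ is the full subcategory of the comma category $\mathcal C/Cat$ (objects: functors out of $\mathcal C$; morphisms: functors under $\mathcal C$) whose objects $F:\mathcal C\to\mathcal D$ are the functors such that the localization functor $\mathcal D\to\mathcal D[F(\Sigma)^{-1}]$ is faithful. *)

theory Defs
  imports Main "HOL-Library.FuncSet"
begin

section \<open>Categories and functors\<close>

text \<open>Composition is written in the usual order: \<open>g \<cdot>\<^bsub>C\<^esub> f\<close> is ``\<open>g\<close> after \<open>f\<close>''.\<close>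

record ('o, 'm) cat =
  Obj :: "'o set"
  Mor :: "'m set"
  Dom :: "'m \<Rightarrow> 'o"
  Cod :: "'m \<Rightarrow> 'o"
  Ident :: "'o \<Rightarrow> 'm"
  Comp :: "'m \<Rightarrow> 'm \<Rightarrow> 'm"  (infixl "\<cdot>\<index>" 70)

locale category =
  fixes C :: "('o, 'm) cat" (structure)
  assumes dom_obj: "f \<in> Mor C \<Longrightarrow> Dom C f \<in> Obj C"
    and cod_obj: "f \<in> Mor C \<Longrightarrow> Cod C f \<in> Obj C"
    and ident_mor: "X \<in> Obj C \<Longrightarrow> Ident C X \<in> Mor C"
    and dom_ident: "X \<in> Obj C \<Longrightarrow> Dom C (Ident C X) = X"
    and cod_ident: "X \<in> Obj C \<Longrightarrow> Cod C (Ident C X) = X"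
    and comp_mor: "\<lbrakk>f \<in> Mor C; g \<in> Mor C; Cod C f = Dom C g\<rbrakk> \<Longrightarrow> g \<cdot> f \<in> Mor C"
    and dom_comp: "\<lbrakk>f \<in> Mor C; g \<in> Mor C; Cod C f = Dom C g\<rbrakk> \<Longrightarrow> Dom C (g \<cdot> f) = Dom C f"
    and cod_comp: "\<lbrakk>f \<in> Mor C; g \<in> Mor C; Cod C f = Dom C g\<rbrakk> \<Longrightarrow> Cod C (g \<cdot> f) = Cod C g"
    and comp_ident: "f \<in> Mor C \<Longrightarrow> f \<cdot> Ident C (Dom C f) = f"
    and ident_comp: "f \<in> Mor C \<Longrightarrow> Ident C (Cod C f) \<cdot> f = f"
    and comp_assoc: "\<lbrakk>f \<in> Mor C; g \<in> Mor C; h \<in> Mor C; Cod C f = Dom C g; Cod C g = Dom C h\<rbrakk>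
      \<Longrightarrow> h \<cdot> (g \<cdot> f) = (h \<cdot> g) \<cdot> f"

record ('o, 'm, 'p, 'n) cat_functor =
  FObj :: "'o \<Rightarrow> 'p"
  FMor :: "'m \<Rightarrow> 'n"

text \<open>The object and morphism maps of a functor are taken in the extensional function space
  \<open>\<rightarrow>\<^sub>E\<close>, so that equality of the records is equality of functors.\<close>

definition is_functor ::
    "('o, 'm) cat \<Rightarrow> ('p, 'n) cat \<Rightarrow> ('o, 'm, 'p, 'n) cat_functor \<Rightarrow> bool" where
  "is_functor C D F \<longleftrightarrow> category C \<and> category D \<and>
     FObj F \<in> Obj C \<rightarrow>\<^sub>E Obj D \<and>
     FMor F \<in> Mor C \<rightarrow>\<^sub>E Mor D \<and>
     (\<forall>f\<in>Mor C. Dom D (FMor F f) = FObj F (Dom C f)) \<and>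
     (\<forall>f\<in>Mor C. Cod D (FMor F f) = FObj F (Cod C f)) \<and>
     (\<forall>X\<in>Obj C. FMor F (Ident C X) = Ident D (FObj F X)) \<and>
     (\<forall>f\<in>Mor C. \<forall>g\<in>Mor C. Cod C f = Dom C g \<longrightarrow>
        FMor F (g \<cdot>\<^bsub>C\<^esub> f) = FMor F g \<cdot>\<^bsub>D\<^esub> FMor F f)"

definition functor_comp ::
    "('o, 'm) cat \<Rightarrow> ('p, 'n, 'q, 'k) cat_functor \<Rightarrow> ('o, 'm, 'p, 'n) cat_functor
      \<Rightarrow> ('o, 'm, 'q, 'k) cat_functor" where
  "functor_comp C G F =
     \<lparr>FObj = compose (Obj C) (FObj G) (FObj F), FMor = compose (Mor C) (FMor G) (FMor F)\<rparr>"

definition faithful :: "('o, 'm) cat \<Rightarrow> ('o, 'm, 'p, 'n) cat_functor \<Rightarrow> bool" where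
  "faithful C F \<longleftrightarrow>
     (\<forall>f\<in>Mor C. \<forall>g\<in>Mor C. Dom C f = Dom C g \<longrightarrow> Cod C f = Cod C g \<longrightarrow>
        FMor F f = FMor F g \<longrightarrow> f = g)"


section \<open>Sieves\<close>

definition sieve :: "('o, 'm) cat \<Rightarrow> 'm set \<Rightarrow> bool" where
  "sieve C S \<longleftrightarrow> S \<subseteq> Mor C \<and>
     (\<forall>e\<in>S. \<forall>n\<in>Mor C. Cod C n = Dom C e \<longrightarrow> e \<cdot>\<^bsub>C\<^esub> n \<in> S)"

definition sieve_over :: "('o, 'm) cat \<Rightarrow> 'o \<Rightarrow> 'm set \<Rightarrow> bool" where
  "sieve_over C Y S \<longleftrightarrow> sieve C S \<and> (\<forall>e\<in>S. Cod C e = Y)"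

definition sieve_gen :: "('o, 'm) cat \<Rightarrow> 'm set \<Rightarrow> 'm set" where
  "sieve_gen C E = {e \<cdot>\<^bsub>C\<^esub> n | e n. e \<in> E \<and> n \<in> Mor C \<and> Cod C n = Dom C e}"


section \<open>Localization\<close>

text \<open>The directed lines of the graph: \<open>Fwd a\<close> is the line attached to a morphism \<open>a\<close>, and
  \<open>Bwd d\<close> is the line \<open>l\<^sub>d\<close> from the codomain to the domain of \<open>d \<in> \<Sigma>\<close>.\<close>

datatype 'm line = Fwd 'm | Bwd 'm

fun line_in :: "('o, 'm) cat \<Rightarrow> 'm set \<Rightarrow> 'm line \<Rightarrow> bool" where
  "line_in C \<Sigma> (Fwd a) \<longleftrightarrow> a \<in> Mor C"
| "line_in C \<Sigma> (Bwd d) \<longleftrightarrow> d \<in> \<Sigma>"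

fun line_dom :: "('o, 'm) cat \<Rightarrow> 'm line \<Rightarrow> 'o" where
  "line_dom C (Fwd a) = Dom C a"
| "line_dom C (Bwd d) = Cod C d"

fun line_cod :: "('o, 'm) cat \<Rightarrow> 'm line \<Rightarrow> 'o" where
  "line_cod C (Fwd a) = Cod C a"
| "line_cod C (Bwd d) = Dom C d"

text \<open>A \<open>\<Sigma>\<close>-sequence is a pair \<open>(X, ls)\<close> of its starting object and the list of its lines in order
  of traversal; the starting object is recorded because of the empty sequences \<open>(X, [])\<close>.\<close>

type_synonym ('o, 'm) line_seq = "'o \<times> 'm line list"

fun path_from :: "('o, 'm) cat \<Rightarrow> 'm set \<Rightarrow> 'o \<Rightarrow> 'm line list \<Rightarrow> bool" where
  "path_from C \<Sigma> X [] \<longleftrightarrow> X \<in> Obj C"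
| "path_from C \<Sigma> X (l # ls) \<longleftrightarrow>
     line_in C \<Sigma> l \<and> line_dom C l = X \<and> path_from C \<Sigma> (line_cod C l) ls"

definition sequences :: "('o, 'm) cat \<Rightarrow> 'm set \<Rightarrow> ('o, 'm) line_seq set" where
  "sequences C \<Sigma> = {(X, ls). path_from C \<Sigma> X ls}"

definition seq_dom :: "('o, 'm) line_seq \<Rightarrow> 'o" where
  "seq_dom s = fst s"

definition seq_cod :: "('o, 'm) cat \<Rightarrow> ('o, 'm) line_seq \<Rightarrow> 'o" where
  "seq_cod C s = (if snd s = [] then fst s else line_cod C (last (snd s)))"

definition seq_append :: "('o, 'm) line_seq \<Rightarrow> ('o, 'm) line_seq \<Rightarrow> ('o, 'm) line_seq" where
  "seq_append s t = (fst s, snd s @ snd t)"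

inductive replacement :: "('o, 'm) cat \<Rightarrow> 'm set \<Rightarrow> 'm line list \<Rightarrow> 'm line list \<Rightarrow> bool"
  for C \<Sigma> where
  comp: "\<lbrakk>a \<in> Mor C; a' \<in> Mor C; Cod C a = Dom C a'\<rbrakk>
    \<Longrightarrow> replacement C \<Sigma> [Fwd a, Fwd a'] [Fwd (a' \<cdot>\<^bsub>C\<^esub> a)]"
| inv_left: "d \<in> \<Sigma> \<Longrightarrow> replacement C \<Sigma> [Bwd d, Fwd d] []"
| inv_right: "d \<in> \<Sigma> \<Longrightarrow> replacement C \<Sigma> [Fwd d, Bwd d] []"
| ident: "X \<in> Obj C \<Longrightarrow> replacement C \<Sigma> [Fwd (Ident C X)] []"

text \<open>Both sides of a step are required to be \<open>\<Sigma>\<close>-sequences; this makes the implicit source and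
  target of the empty replacements match the place where they are inserted.\<close>

inductive seq_step ::
    "('o, 'm) cat \<Rightarrow> 'm set \<Rightarrow> ('o, 'm) line_seq \<Rightarrow> ('o, 'm) line_seq \<Rightarrow> bool"
  for C \<Sigma> where
  "\<lbrakk>replacement C \<Sigma> r r'; (X, p @ r @ q) \<in> sequences C \<Sigma>; (X, p @ r' @ q) \<in> sequences C \<Sigma>\<rbrakk>
    \<Longrightarrow> seq_step C \<Sigma> (X, p @ r @ q) (X, p @ r' @ q)"

definition seq_class ::
    "('o, 'm) cat \<Rightarrow> 'm set \<Rightarrow> ('o, 'm) line_seq \<Rightarrow> ('o, 'm) line_seq set" where
  "seq_class C \<Sigma> s = {t. equivclp (seq_step C \<Sigma>) s t}"

definition fractions :: "('o, 'm) cat \<Rightarrow> 'm set \<Rightarrow> ('o, 'm) line_seq set set" where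
  "fractions C \<Sigma> = seq_class C \<Sigma> ` sequences C \<Sigma>"

text \<open>Equivalent \<open>\<Sigma>\<close>-sequences share their domain and codomain, so the images under \<open>the_elem\<close>
  are singletons; likewise the union defining the composite is a single class.\<close>

definition localization ::
    "('o, 'm) cat \<Rightarrow> 'm set \<Rightarrow> ('o, ('o, 'm) line_seq set) cat" where
  "localization C \<Sigma> =
     \<lparr>Obj = Obj C,
      Mor = fractions C \<Sigma>,
      Dom = (\<lambda>x. the_elem (seq_dom ` x)),
      Cod = (\<lambda>x. the_elem (seq_cod C ` x)),
      Ident = (\<lambda>X. seq_class C \<Sigma> (X, [])),
      Comp = (\<lambda>y x. \<Union>s\<in>x. \<Union>t\<in>y. seq_class C \<Sigma> (seq_append s t))\<rparr>"

definition localization_functor ::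
    "('o, 'm) cat \<Rightarrow> 'm set \<Rightarrow> ('o, 'm, 'o, ('o, 'm) line_seq set) cat_functor" where
  "localization_functor C \<Sigma> =
     \<lparr>FObj = (\<lambda>X\<in>Obj C. X), FMor = (\<lambda>a\<in>Mor C. seq_class C \<Sigma> (Dom C a, [Fwd a]))\<rparr>"


section \<open>Dilatations\<close>

definition center ::
    "('o, 'm) cat \<Rightarrow> 'i set \<Rightarrow> ('i \<Rightarrow> 'm set) \<Rightarrow> ('i \<Rightarrow> 'm) \<Rightarrow> bool" where
  "center C I N d \<longleftrightarrow> (\<forall>i\<in>I. d i \<in> Mor C \<and> sieve_over C (Cod C (d i)) (N i))"

text \<open>The list of pairs \<open>(i\<^sub>j, n\<^sub>j)\<close> of length \<open>k\<close> encodes the sequence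
  \<open>n\<^sub>1, l, \<dots>, n\<^sub>k, l, a\<close>, the \<open>j\<close>-th backward line being that of \<open>d i\<^sub>j\<close>.\<close>

definition center_fractions ::
    "('o, 'm) cat \<Rightarrow> 'i set \<Rightarrow> ('i \<Rightarrow> 'm set) \<Rightarrow> ('i \<Rightarrow> 'm) \<Rightarrow> ('o, 'm) line_seq set set" where
  "center_fractions C I N d =
     {seq_class C (d ` I) (X, concat (map (\<lambda>(i, n). [Fwd n, Bwd (d i)]) ps) @ [Fwd a]) | X ps a.
        (\<forall>(i, n)\<in>set ps. i \<in> I \<and> n \<in> N i) \<and> a \<in> Mor C \<and>
        (X, concat (map (\<lambda>(i, n). [Fwd n, Bwd (d i)]) ps) @ [Fwd a]) \<in> sequences C (d ` I)}"

definition dilatation ::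
    "('o, 'm) cat \<Rightarrow> 'i set \<Rightarrow> ('i \<Rightarrow> 'm set) \<Rightarrow> ('i \<Rightarrow> 'm)
      \<Rightarrow> ('o, ('o, 'm) line_seq set) cat" where
  "dilatation C I N d = (localization C (d ` I))\<lparr>Mor := center_fractions C I N d\<rparr>"

definition dilatation_functor ::
    "('o, 'm) cat \<Rightarrow> 'i set \<Rightarrow> ('i \<Rightarrow> 'm) \<Rightarrow> ('o, 'm, 'o, ('o, 'm) line_seq set) cat_functor" where
  "dilatation_functor C I d =
     \<lparr>FObj = (\<lambda>X\<in>Obj C. X), FMor = (\<lambda>a\<in>Mor C. seq_class C (d ` I) (Dom C a, [Fwd a]))\<rparr>"

text \<open>The objects \<open>F : C \<rightarrow> D\<close> of the full subcategory of \<open>\<Sigma>\<close>-regular functors in the category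
  of functors out of \<open>C\<close>.\<close>

definition regular_functor ::
    "('o, 'm) cat \<Rightarrow> 'm set \<Rightarrow> ('p, 'n) cat \<Rightarrow> ('o, 'm, 'p, 'n) cat_functor \<Rightarrow> bool" where
  "regular_functor C \<Sigma> D F \<longleftrightarrow>
     is_functor C D F \<and> faithful D (localization_functor D (FMor F ` \<Sigma>))"

end

theory Submission
  imports Defs
begin

text \<open>For \<open>n \<in> N\<^sub>i\<close> the hypothesis on sieves gives \<open>F n = F d\<^sub>i \<cdot> b\<close>, so in the localization of \<open>D\<close> at
  \<open>F(\<Sigma>)\<close> the image of the sequence \<open>n, l\<^bsub>d\<^sub>i\<^esub>\<close> is the class of the genuine morphism \<open>b\<close>. Hence the image
  of every fraction of the dilatation is represented by a morphism of \<open>D\<close>, which is unique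
  because \<open>D\<close> embeds faithfully in its localization; this representative is the value of \<open>F'\<close>.\<close>

section \<open>The localization category\<close>

text \<open>Induction along a chain of steps. The chain may run either way, so \<open>P\<close> must
  be invariant in both directions; \<open>map\<close> is then needed only at points satisfying
  \<open>P\<close>.\<close>

lemma equivclp_map_inv:
  assumes "equivclp r x y" "P x"
    and inv: "\<And>u v. r u v \<Longrightarrow> P u \<longleftrightarrow> P v"
    and map: "\<And>u v. r u v \<Longrightarrow> P u \<Longrightarrow> equivclp r' (f u) (f v)"
  shows "P y \<and> equivclp r' (f x) (f y)"
  using assms(1)
proof (induction rule: equivclp_induct)
  case base
  then show ?case using \<open>P x\<close> by simp
next
  case (step y z)
  then have "P z" using inv by blast
  with step have "equivclp r' (f y) (f z)"
    by (metis map equivclp_sym)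
  with step \<open>P z\<close> show ?case by (meson equivclp_trans)
qed

text \<open>\<open>seq_cod\<close> is defined through the last line; these equations let inductions
  run from the front, as \<open>path_from\<close> does.\<close>

lemma seq_cod_simps [simp]:
  "seq_cod C (X, []) = X"
  "seq_cod C (X, l # ls) = seq_cod C (line_cod C l, ls)"
  by (auto simp: seq_cod_def)

lemma seq_cod_append [simp]: "seq_cod C (X, p @ q) = seq_cod C (seq_cod C (X, p), q)"
  by (auto simp: seq_cod_def)

locale localizing = category C for C :: "('o, 'm) cat" (structure) +
  fixes \<Sigma> :: "'m set"
  assumes \<Sigma>_mor: "\<Sigma> \<subseteq> Mor C"
begin

section \<open>Equivalence of sequences and concatenation\<close>

abbreviation seq_eqv (infix "\<simeq>" 50) where
  "s \<simeq> t \<equiv> equivclp (seq_step C \<Sigma>) s t"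

lemma line_dom_obj: "line_in C \<Sigma> l \<Longrightarrow> line_dom C l \<in> Obj C"
  using \<Sigma>_mor by (cases l) (auto intro: dom_obj cod_obj)

lemma path_from_start: "path_from C \<Sigma> X ls \<Longrightarrow> X \<in> Obj C"
  by (cases ls) (auto intro: line_dom_obj)

lemma path_from_append:
  "path_from C \<Sigma> X (p @ q) \<longleftrightarrow> path_from C \<Sigma> X p \<and> path_from C \<Sigma> (seq_cod C (X, p)) q"
  by (induction p arbitrary: X) (auto dest: path_from_start)

lemma path_from_end: "path_from C \<Sigma> X ls \<Longrightarrow> seq_cod C (X, ls) \<in> Obj C"
  by (induction ls arbitrary: X) auto

lemma replacement_path:
  assumes "replacement C \<Sigma> r r'" "path_from C \<Sigma> X r"
  shows "path_from C \<Sigma> X r' \<and> seq_cod C (X, r') = seq_cod C (X, r)"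
  using assms(1)
  by (cases rule: replacement.cases)
    (use assms(2) \<Sigma>_mor in \<open>auto simp: comp_mor dom_comp cod_comp dom_ident cod_ident dom_obj cod_obj\<close>)

text \<open>A replacement preserves paths and their ends, so the demand of \<open>seq_step\<close>
  that the new list be a sequence holds automatically once the old list is one.\<close>

lemma replacement_eqv:
  assumes "replacement C \<Sigma> r r'" "(X, p @ r @ q) \<in> sequences C \<Sigma>"
  shows "(X, p @ r @ q) \<simeq> (X, p @ r' @ q)"
proof -
  have "(X, p @ r' @ q) \<in> sequences C \<Sigma>"
    using assms(2) replacement_path[OF assms(1)]
    by (auto simp: sequences_def path_from_append)
  then show ?thesis
    using assms by (intro r_into_equivclp seq_step.intros)
qed

lemma seq_step_ends:
  assumes "seq_step C \<Sigma> s t"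
  shows "s \<in> sequences C \<Sigma>" "t \<in> sequences C \<Sigma>" "fst s = fst t" "seq_cod C s = seq_cod C t"
proof -
  obtain r r' X p q where st: "s = (X, p @ r @ q)" "t = (X, p @ r' @ q)" "replacement C \<Sigma> r r'"
    "s \<in> sequences C \<Sigma>" "t \<in> sequences C \<Sigma>"
    using assms by (cases rule: seq_step.cases) auto
  then show "s \<in> sequences C \<Sigma>" "t \<in> sequences C \<Sigma>" "fst s = fst t" by auto
  from st have "path_from C \<Sigma> (seq_cod C (X, p)) r"
    by (auto simp: sequences_def path_from_append)
  with st show "seq_cod C s = seq_cod C t"
    using replacement_path by auto
qed

lemma eqv_ends:
  assumes "s \<simeq> t" "s \<in> sequences C \<Sigma>"
  shows "t \<in> sequences C \<Sigma>" "fst t = fst s" "seq_cod C t = seq_cod C s"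
  \<comment> \<open>With \<open>f\<close> the identity, only the invariance of \<open>P\<close>
    matters here.\<close>
  using equivclp_map_inv[OF assms(1), where P = "\<lambda>u. u \<in> sequences C \<Sigma> \<and> fst u = fst s \<and>
      seq_cod C u = seq_cod C s" and r' = "seq_step C \<Sigma>" and f = "\<lambda>u. u"] assms(2)
  by (auto simp: seq_step_ends)

lemma fst_seq_append [simp]: "fst (seq_append s t) = fst s"
  by (simp add: seq_append_def)

lemma seq_cod_seq_append:
  "seq_cod C s = fst t \<Longrightarrow> seq_cod C (seq_append s t) = seq_cod C t"
  by (cases s; cases t) (auto simp: seq_append_def)

lemma seq_append_in_sequences:
  "\<lbrakk>s \<in> sequences C \<Sigma>; t \<in> sequences C \<Sigma>; seq_cod C s = fst t\<rbrakk>
    \<Longrightarrow> seq_append s t \<in> sequences C \<Sigma>"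
  by (auto simp: sequences_def seq_append_def path_from_append)

text \<open>\<open>t\<close> joins the right context of every step. Steps preserve codomains, so
  composability with \<open>t\<close> persists along the whole chain.\<close>

lemma eqv_append_left:
  assumes "s \<simeq> s'" "s \<in> sequences C \<Sigma>" "t \<in> sequences C \<Sigma>" "seq_cod C s = fst t"
  shows "seq_append s t \<simeq> seq_append s' t"
proof -
  have "seq_append u t \<simeq> seq_append v t" if "seq_step C \<Sigma> u v" "seq_cod C u = fst t" for u v
    using that(1)
  proof (cases rule: seq_step.cases)
    case (1 r r' X p q)
    with that have "seq_append u t \<in> sequences C \<Sigma>"
      using assms(3) by (intro seq_append_in_sequences) auto
    with 1 show ?thesis
      using replacement_eqv[of r r' X p "q @ snd t"] by (simp add: seq_append_def)
  qed
  then show ?thesis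
    using equivclp_map_inv[OF assms(1), where P = "\<lambda>u. seq_cod C u = fst t"
        and f = "\<lambda>u. seq_append u t"] assms(4)
    by (metis seq_step_ends(4))
qed

lemma eqv_append_right:
  assumes "t \<simeq> t'" "s \<in> sequences C \<Sigma>" "t \<in> sequences C \<Sigma>" "seq_cod C s = fst t"
  shows "seq_append s t \<simeq> seq_append s t'"
proof -
  have "seq_append s u \<simeq> seq_append s v" if "seq_step C \<Sigma> u v" "seq_cod C s = fst u" for u v
    using that(1)
  proof (cases rule: seq_step.cases)
    case (1 r r' X p q)
    with that have "seq_append s u \<in> sequences C \<Sigma>"
      using assms(2) by (intro seq_append_in_sequences) auto
    with 1 show ?thesis
      using replacement_eqv[of r r' "fst s" "snd s @ p" q] by (simp add: seq_append_def)
  qed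
  then show ?thesis
    using equivclp_map_inv[OF assms(1), where P = "\<lambda>u. seq_cod C s = fst u"
        and f = "seq_append s"] assms(4)
    by (metis seq_step_ends(3))
qed

lemma eqv_append:
  assumes "s \<simeq> s'" "t \<simeq> t'" "s \<in> sequences C \<Sigma>" "t \<in> sequences C \<Sigma>" "seq_cod C s = fst t"
  shows "seq_append s t \<simeq> seq_append s' t'"
proof -
  have "seq_append s t \<simeq> seq_append s' t"
    using assms by (intro eqv_append_left)
  moreover have "seq_append s' t \<simeq> seq_append s' t'"
    using assms eqv_ends[OF assms(1,3)] by (intro eqv_append_right) auto
  ultimately show ?thesis by (rule equivclp_trans)
qed

section \<open>Classes of sequences as morphisms of a category\<close>

lemma seq_class_self: "s \<in> seq_class C \<Sigma> s"
  by (simp add: seq_class_def)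

lemma seq_class_eq_iff: "seq_class C \<Sigma> s = seq_class C \<Sigma> t \<longleftrightarrow> s \<simeq> t"
  unfolding seq_class_def by (auto intro: equivclp_trans equivclp_sym)

lemma seq_class_eqI: "s \<simeq> t \<Longrightarrow> seq_class C \<Sigma> s = seq_class C \<Sigma> t"
  by (simp add: seq_class_eq_iff)

lemma the_elem_seq_class:
  assumes "\<And>t. s \<simeq> t \<Longrightarrow> f t = f s"
  shows "the_elem (f ` seq_class C \<Sigma> s) = f s"
proof -
  have "f ` seq_class C \<Sigma> s = {f s}"
    using assms imageI[OF seq_class_self, of f s] unfolding seq_class_def by blast
  then show ?thesis by simp
qed

lemma Dom_localization:
  "s \<in> sequences C \<Sigma> \<Longrightarrow> Dom (localization C \<Sigma>) (seq_class C \<Sigma> s) = fst s"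
  using the_elem_seq_class[of s seq_dom]
  by (simp add: localization_def seq_dom_def eqv_ends)

lemma Cod_localization:
  "s \<in> sequences C \<Sigma> \<Longrightarrow> Cod (localization C \<Sigma>) (seq_class C \<Sigma> s) = seq_cod C s"
  using the_elem_seq_class[of s "seq_cod C"]
  by (simp add: localization_def eqv_ends)

text \<open>The union over all representatives collapses to one class because concatenation respects
  equivalence in both arguments.\<close>

lemma Comp_localization:
  assumes "s \<in> sequences C \<Sigma>" "t \<in> sequences C \<Sigma>" "seq_cod C s = fst t"
  shows "Comp (localization C \<Sigma>) (seq_class C \<Sigma> t) (seq_class C \<Sigma> s)
    = seq_class C \<Sigma> (seq_append s t)"
proof -
  have "(\<Union>s'\<in>seq_class C \<Sigma> s. \<Union>t'\<in>seq_class C \<Sigma> t. seq_class C \<Sigma> (seq_append s' t'))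
      = seq_class C \<Sigma> (seq_append s t)" (is "?U = ?V")
  proof
    show "?V \<subseteq> ?U" using seq_class_self[of s] seq_class_self[of t] by blast
    show "?U \<subseteq> ?V"
    proof (intro UN_least)
      fix s' t' assume "s' \<in> seq_class C \<Sigma> s" "t' \<in> seq_class C \<Sigma> t"
      then have "seq_append s t \<simeq> seq_append s' t'"
        using assms by (intro eqv_append) (simp_all add: seq_class_def)
      then show "seq_class C \<Sigma> (seq_append s' t') \<subseteq> ?V"
        by (simp add: seq_class_eqI)
    qed
  qed
  then show ?thesis by (simp add: localization_def)
qed

lemma localization_simps [simp]:
  "Obj (localization C \<Sigma>) = Obj C"
  "Ident (localization C \<Sigma>) = (\<lambda>X. seq_class C \<Sigma> (X, []))"
  "Mor (localization C \<Sigma>) = fractions C \<Sigma>"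
  by (auto simp: localization_def)

lemma empty_in_sequences: "X \<in> Obj C \<Longrightarrow> (X, []) \<in> sequences C \<Sigma>"
  by (simp add: sequences_def)

lemma single_in_sequences: "a \<in> Mor C \<Longrightarrow> (Dom C a, [Fwd a]) \<in> sequences C \<Sigma>"
  by (simp add: sequences_def cod_obj)

lemma seq_ends_obj:
  "(X, ls) \<in> sequences C \<Sigma> \<Longrightarrow> X \<in> Obj C" "s \<in> sequences C \<Sigma> \<Longrightarrow> seq_cod C s \<in> Obj C"
  by (auto simp: sequences_def dest: path_from_start path_from_end)

lemma seq_append_empty [simp]:
  "seq_append s (X, []) = s" "fst s = X \<Longrightarrow> seq_append (X, []) s = s"
  by (auto simp: seq_append_def)

lemma seq_append_assoc: "seq_append (seq_append s t) u = seq_append s (seq_append t u)"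
  by (simp add: seq_append_def)

text \<open>Once computed on representatives, the category axioms reduce to the unit and
  associativity laws of list concatenation.\<close>

lemma category_localization: "category (localization C \<Sigma>)"
  unfolding category_def localization_simps fractions_def
  by (auto simp: Dom_localization Cod_localization Comp_localization seq_ends_obj
      empty_in_sequences seq_append_in_sequences seq_cod_seq_append seq_append_assoc)

section \<open>The generating relations inside an arbitrary context\<close>

lemma eqv_inv_right: "e \<in> \<Sigma> \<Longrightarrow> (X, p @ Fwd e # Bwd e # q) \<in> sequences C \<Sigma>
    \<Longrightarrow> (X, p @ Fwd e # Bwd e # q) \<simeq> (X, p @ q)"
  using replacement_eqv[OF replacement.inv_right, of e X p q] by simp

lemma eqv_inv_left: "e \<in> \<Sigma> \<Longrightarrow> (X, p @ Bwd e # Fwd e # q) \<in> sequences C \<Sigma>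
    \<Longrightarrow> (X, p @ Bwd e # Fwd e # q) \<simeq> (X, p @ q)"
  using replacement_eqv[OF replacement.inv_left, of e X p q] by simp

lemma eqv_ident: "Y \<in> Obj C \<Longrightarrow> (X, p @ Fwd (Ident C Y) # q) \<in> sequences C \<Sigma>
    \<Longrightarrow> (X, p @ Fwd (Ident C Y) # q) \<simeq> (X, p @ q)"
  using replacement_eqv[OF replacement.ident, of Y X p q] by simp

lemma eqv_comp:
  assumes "(X, p @ Fwd a # Fwd b # q) \<in> sequences C \<Sigma>"
  shows "(X, p @ Fwd a # Fwd b # q) \<simeq> (X, p @ Fwd (b \<cdot> a) # q)"
proof -
  have "replacement C \<Sigma> [Fwd a, Fwd b] [Fwd (b \<cdot> a)]"
    using assms by (intro replacement.comp) (auto simp: sequences_def path_from_append)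
  from replacement_eqv[OF this, of X p q] assms show ?thesis by simp
qed

end

section \<open>The dilatation category\<close>

text \<open>The same list of lines as in \<open>center_fractions\<close>, named so that it can be
  handled by recursion on \<open>ps\<close>.\<close>

definition center_path :: "('i \<Rightarrow> 'm) \<Rightarrow> ('i \<times> 'm) list \<Rightarrow> 'm \<Rightarrow> 'm line list" where
  "center_path d ps a = concat (map (\<lambda>(i, n). [Fwd n, Bwd (d i)]) ps) @ [Fwd a]"

lemma center_path_simps [simp]:
  "center_path d [] a = [Fwd a]"
  "center_path d ((i, n) # ps) a = Fwd n # Bwd (d i) # center_path d ps a"
  by (auto simp: center_path_def)

text \<open>The axioms pass to a subcategory with all objects; only its closure under identities and
  composition has to be supplied.\<close>

lemma category_Mor_restrict:
  assumes "category L" and sub: "M \<subseteq> Mor L"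
    and ident: "\<And>X. X \<in> Obj L \<Longrightarrow> Ident L X \<in> M"
    and comp: "\<And>f g. \<lbrakk>f \<in> M; g \<in> M; Cod L f = Dom L g\<rbrakk> \<Longrightarrow> g \<cdot>\<^bsub>L\<^esub> f \<in> M"
  shows "category (L\<lparr>Mor := M\<rparr>)"
proof -
  interpret category L by fact
  show ?thesis
    using ident comp
    by unfold_locales (simp_all add: subsetD[OF sub] dom_obj cod_obj dom_ident cod_ident
        dom_comp cod_comp comp_ident ident_comp comp_assoc)
qed

locale centered = category C for C :: "('o, 'm) cat" (structure) +
  fixes I :: "'i set" and N :: "'i \<Rightarrow> 'm set" and d :: "'i \<Rightarrow> 'm"
  assumes center: "center C I N d"
begin

sublocale localizing C "d ` I"
  using center by unfold_locales (auto simp: center_def)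

abbreviation center_eqv (infix "\<simeq>" 50) where "(\<simeq>) \<equiv> equivclp (seq_step C (d ` I))"
abbreviation cls where "cls \<equiv> seq_class C (d ` I)"
abbreviation seqs where "seqs \<equiv> sequences C (d ` I)"
abbreviation pairs where "pairs \<equiv> {(i, n). i \<in> I \<and> n \<in> N i}"

lemma center_facts:
  assumes "i \<in> I"
  shows "d i \<in> Mor C" "\<And>n. n \<in> N i \<Longrightarrow> n \<in> Mor C"
    "\<And>n. n \<in> N i \<Longrightarrow> Cod C n = Cod C (d i)"
    "\<And>n a. \<lbrakk>n \<in> N i; a \<in> Mor C; Cod C a = Dom C n\<rbrakk> \<Longrightarrow> n \<cdot> a \<in> N i"
  using center assms by (auto simp: center_def sieve_over_def sieve_def)

lemma center_fractions_eq:
  "center_fractions C I N d = {cls (X, center_path d ps a) | X ps a.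
     set ps \<subseteq> pairs \<and> a \<in> Mor C \<and> (X, center_path d ps a) \<in> seqs}"
  unfolding center_fractions_def center_path_def by (intro Collect_cong) (simp add: subset_eq)

lemma center_fractionsI:
  "\<lbrakk>set ps \<subseteq> pairs; a \<in> Mor C; (X, center_path d ps a) \<in> seqs\<rbrakk>
    \<Longrightarrow> cls (X, center_path d ps a) \<in> center_fractions C I N d"
  by (auto simp: center_fractions_eq)

lemma center_fractions_subset: "center_fractions C I N d \<subseteq> fractions C (d ` I)"
  by (auto simp: center_fractions_eq fractions_def)

lemma dilatation_simps [simp]:
  "Obj (dilatation C I N d) = Obj C"
  "Mor (dilatation C I N d) = center_fractions C I N d"
  "Dom (dilatation C I N d) = Dom (localization C (d ` I))"
  "Cod (dilatation C I N d) = Cod (localization C (d ` I))"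
  "Ident (dilatation C I N d) = Ident (localization C (d ` I))"
  "Comp (dilatation C I N d) = Comp (localization C (d ` I))"
  by (simp_all add: dilatation_def)

lemma single_in_center_fractions:
  assumes "a \<in> Mor C"
  shows "cls (Dom C a, [Fwd a]) \<in> center_fractions C I N d"
  using center_fractionsI[of "[]" a "Dom C a"] single_in_sequences[OF assms] assms by simp

text \<open>Center paths always end in a forward line, so an empty sequence is not of this form;
  this equality is what brings identities into the dilatation.\<close>

lemma cls_ident: "X \<in> Obj C \<Longrightarrow> cls (X, [Fwd (Ident C X)]) = cls (X, [])"
  using eqv_ident[of X X "[]" "[]"] single_in_sequences[OF ident_mor[of X]]
  by (intro seq_class_eqI) (simp add: dom_ident)

lemma empty_in_center_fractions:
  assumes "X \<in> Obj C"
  shows "cls (X, []) \<in> center_fractions C I N d"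
  using single_in_center_fractions[OF ident_mor[OF assms]] cls_ident[OF assms] assms
  by (simp add: dom_ident)

text \<open>Concatenating two center paths leaves the final morphism \<open>a\<close> of the first
  in the middle. It is absorbed by composition with the forward line that follows it.\<close>

lemma Comp_in_center_fractions:
  assumes "x \<in> center_fractions C I N d" "y \<in> center_fractions C I N d"
    and xy: "Cod (localization C (d ` I)) x = Dom (localization C (d ` I)) y"
  shows "Comp (localization C (d ` I)) y x \<in> center_fractions C I N d"
proof -
  obtain X ps a where x: "x = cls (X, center_path d ps a)" "set ps \<subseteq> pairs" "a \<in> Mor C"
    "(X, center_path d ps a) \<in> seqs"
    using assms(1) unfolding center_fractions_eq by blast
  obtain Y qs b where y: "y = cls (Y, center_path d qs b)" "set qs \<subseteq> pairs" "b \<in> Mor C"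
    "(Y, center_path d qs b) \<in> seqs"
    using assms(2) unfolding center_fractions_eq by blast
  have Y: "seq_cod C (X, center_path d ps a) = Y"
    using xy x(4) y(4) by (simp add: x(1) y(1) Cod_localization Dom_localization)
  then have Ca: "Cod C a = Y" by (simp add: center_path_def)
  have comp: "Comp (localization C (d ` I)) y x = cls (X, center_path d ps a @ center_path d qs b)"
    using x(4) y(4) Y by (simp add: x(1) y(1) Comp_localization seq_append_def)
  have in_seqs: "(X, center_path d ps a @ center_path d qs b) \<in> seqs"
    using seq_append_in_sequences[OF x(4) y(4)] Y by (simp add: seq_append_def)
  show ?thesis
  proof (cases qs)
    \<comment> \<open>The second path is the single line \<open>b\<close>, so \<open>a\<close>
      merges into a new final morphism.\<close>
    case Nil
    then have *: "(X, center_path d ps a @ center_path d qs b) \<simeq> (X, center_path d ps (b \<cdot> a))"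
      using eqv_comp[of X "concat (map (\<lambda>(i, n). [Fwd n, Bwd (d i)]) ps)" a b "[]"] in_seqs
      by (simp add: center_path_def)
    moreover have "Dom C b = Y"
      using y(4) Nil by (auto simp: sequences_def)
    ultimately show ?thesis
      unfolding comp seq_class_eqI[OF *]
      using x(2,3) y(3) Ca eqv_ends(1)[OF * in_seqs]
      by (intro center_fractionsI) (auto simp: comp_mor)
  next
    \<comment> \<open>Here \<open>a\<close> merges into the first numerator \<open>n\<close> of the
      second path; stability of the sieve \<open>N i\<close> under precomposition keeps
      \<open>n \<cdot> a\<close> admissible.\<close>
    case (Cons q qs')
    obtain i n where q: "q = (i, n)" by (cases q)
    then have i: "i \<in> I" "n \<in> N i" using y(2) Cons by auto
    let ?rs = "ps @ (i, n \<cdot> a) # qs'"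
    have *: "(X, center_path d ps a @ center_path d qs b) \<simeq> (X, center_path d ?rs b)"
      using eqv_comp[of X "concat (map (\<lambda>(i, n). [Fwd n, Bwd (d i)]) ps)" a n] in_seqs Cons q
      by (simp add: center_path_def)
    have "Dom C n = Y"
      using y(4) Cons q by (auto simp: sequences_def)
    then have "n \<cdot> a \<in> N i"
      using center_facts(4)[OF i] x(3) Ca by simp
    then show ?thesis
      unfolding comp seq_class_eqI[OF *]
      using x(2) y(2,3) Cons i eqv_ends(1)[OF * in_seqs]
      by (intro center_fractionsI) auto
  qed
qed

lemma category_dilatation: "category (dilatation C I N d)"
  unfolding dilatation_def
  using category_localization center_fractions_subset empty_in_center_fractions
    Comp_in_center_fractions
  by (intro category_Mor_restrict) simp_all

end

section \<open>The factorization\<close>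

locale regular_dilatation = centered C I N d
  for C :: "('o, 'm) cat" (structure) and I :: "'i set" and N d +
  fixes D :: "('p, 'n) cat" and F :: "('o, 'm, 'p, 'n) cat_functor"
  assumes regular: "regular_functor C (d ` I) D F"
    and sieves: "\<And>i. i \<in> I \<Longrightarrow> sieve_gen D (FMor F ` N i) \<subseteq> sieve_gen D {FMor F (d i)}"
begin

lemma F_functor: "is_functor C D F"
  using regular by (simp add: regular_functor_def)

lemma F_facts:
  "X \<in> Obj C \<Longrightarrow> FObj F X \<in> Obj D"
  "a \<in> Mor C \<Longrightarrow> FMor F a \<in> Mor D"
  "a \<in> Mor C \<Longrightarrow> Dom D (FMor F a) = FObj F (Dom C a)"
  "a \<in> Mor C \<Longrightarrow> Cod D (FMor F a) = FObj F (Cod C a)"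
  "X \<in> Obj C \<Longrightarrow> FMor F (Ident C X) = Ident D (FObj F X)"
  "\<lbrakk>a \<in> Mor C; b \<in> Mor C; Cod C a = Dom C b\<rbrakk>
    \<Longrightarrow> FMor F (b \<cdot> a) = FMor F b \<cdot>\<^bsub>D\<^esub> FMor F a"
  using F_functor by (auto simp: is_functor_def)

lemma F_extensional: "FObj F \<in> extensional (Obj C)" "FMor F \<in> extensional (Mor C)"
  using F_functor by (simp_all add: is_functor_def PiE_def)

section \<open>Images of sequences in the localization of \<open>D\<close>\<close>

sublocale D: localizing D "FMor F ` d ` I"
proof -
  have "category D" using F_functor by (simp add: is_functor_def)
  then interpret category D .
  show "localizing D (FMor F ` d ` I)"
    by unfold_locales (auto simp: F_facts center_facts)
qed

text \<open>The action on representatives of the functor that \<open>F\<close> induces between the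
  two localizations. Staying at the level of sequences avoids constructing that functor.\<close>

definition image_seq :: "('o, 'm) line_seq \<Rightarrow> ('p, 'n) line_seq" where
  "image_seq s = (FObj F (fst s), map (map_line (FMor F)) (snd s))"

lemma image_seq_append: "image_seq (seq_append s t) = seq_append (image_seq s) (image_seq t)"
  by (simp add: image_seq_def seq_append_def)

lemma image_seq_path:
  "path_from C (d ` I) X ls \<Longrightarrow>
    path_from D (FMor F ` d ` I) (FObj F X) (map (map_line (FMor F)) ls) \<and>
    seq_cod D (FObj F X, map (map_line (FMor F)) ls) = FObj F (seq_cod C (X, ls))"
proof (induction ls arbitrary: X)
  case (Cons l ls)
  then show ?case by (cases l) (auto simp: F_facts center_facts)
qed (simp add: F_facts)

lemma image_seq_in_sequences:
  "s \<in> seqs \<Longrightarrow> image_seq s \<in> sequences D (FMor F ` d ` I)"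
  "s \<in> seqs \<Longrightarrow> seq_cod D (image_seq s) = FObj F (seq_cod C s)"
  using image_seq_path by (auto simp: sequences_def image_seq_def)

text \<open>Functoriality sends each generating relation to one of the same kind, which is why
  \<open>image_seq\<close> respects equivalence.\<close>

lemma image_replacement:
  "replacement C (d ` I) r r' \<Longrightarrow>
    replacement D (FMor F ` d ` I) (map (map_line (FMor F)) r) (map (map_line (FMor F)) r')"
  by (induction rule: replacement.induct) (auto simp: F_facts intro!: replacement.intros)

lemma image_eqv:
  assumes "s \<simeq> t"
  shows "D.seq_eqv (image_seq s) (image_seq t)"
proof -
  have "D.seq_eqv (image_seq u) (image_seq v)" if "seq_step C (d ` I) u v" for u v
    using that
  proof (cases rule: seq_step.cases)
    case (1 r r' X p q)
    then show ?thesis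
      using D.replacement_eqv[OF image_replacement[OF 1(3)]]
        image_seq_in_sequences(1)[of "(X, p @ r @ q)"]
      by (simp add: image_seq_def)
  qed
  then show ?thesis
    using equivclp_map_inv[OF assms, where P = "\<lambda>_. True"] by blast
qed

section \<open>Morphisms of \<open>D\<close> representing images of sequences\<close>

definition represents :: "'n \<Rightarrow> ('o, 'm) line_seq \<Rightarrow> bool" where
  "represents m s \<longleftrightarrow> m \<in> Mor D \<and> D.seq_eqv (Dom D m, [Fwd m]) (image_seq s)"

lemma represents_ends:
  assumes "represents m s" "s \<in> seqs"
  shows "m \<in> Mor D" "Dom D m = FObj F (fst s)" "Cod D m = FObj F (seq_cod C s)"
proof -
  show m: "m \<in> Mor D" using assms(1) by (simp add: represents_def)
  show "Dom D m = FObj F (fst s)" "Cod D m = FObj F (seq_cod C s)"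
    using assms D.eqv_ends[OF _ D.single_in_sequences[OF m], of "image_seq s"]
    by (auto simp: represents_def image_seq_in_sequences) (simp add: image_seq_def)
qed

text \<open>Two representing morphisms have the same ends and the same class in the localization of
  \<open>D\<close>, so faithfulness identifies them. This is where regularity of \<open>F\<close>
  enters.\<close>

lemma represents_unique:
  assumes "represents m s" "represents m' s" "s \<in> seqs"
  shows "m = m'"
proof -
  have "D.seq_eqv (Dom D m, [Fwd m]) (Dom D m', [Fwd m'])"
    using assms by (meson represents_def equivclp_sym equivclp_trans)
  moreover have "faithful D (localization_functor D (FMor F ` d ` I))"
    using regular by (simp add: regular_functor_def)
  ultimately show ?thesis
    using represents_ends[OF assms(1,3)] represents_ends[OF assms(2,3)]
    by (simp add: faithful_def localization_functor_def D.seq_class_eq_iff)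
qed

lemma represents_eqv: "\<lbrakk>represents m s; s \<simeq> t\<rbrakk> \<Longrightarrow> represents m t"
  unfolding represents_def by (meson image_eqv equivclp_trans)

lemma represents_Fwd: "a \<in> Mor C \<Longrightarrow> represents (FMor F a) (Dom C a, [Fwd a])"
  by (simp add: represents_def image_seq_def F_facts)

text \<open>Concatenating the one-line sequences of \<open>m\<close> and \<open>m'\<close> gives, by
  a single composition relation, the one-line sequence of their composite.\<close>

lemma represents_append:
  assumes "represents m s" "represents m' t" "s \<in> seqs" "t \<in> seqs" "seq_cod C s = fst t"
  shows "represents (m' \<cdot>\<^bsub>D\<^esub> m) (seq_append s t)"
proof -
  note m = represents_ends[OF assms(1,3)] and m' = represents_ends[OF assms(2,4)]
  have cd: "Cod D m = Dom D m'" using m m' assms(5) by simp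
  let ?s = "(Dom D m, [Fwd m])" and ?t = "(Dom D m', [Fwd m'])"
  have in_D: "?s \<in> sequences D (FMor F ` d ` I)" "?t \<in> sequences D (FMor F ` d ` I)"
    by (rule D.single_in_sequences[OF m(1)] D.single_in_sequences[OF m'(1)])+
  have c: "D.seq_eqv (seq_append ?s ?t) (Dom D m, [Fwd (m' \<cdot>\<^bsub>D\<^esub> m)])"
    using D.eqv_comp[of "Dom D m" "[]" m m' "[]"] D.seq_append_in_sequences[OF in_D] cd
    by (simp add: seq_append_def)
  have "D.seq_eqv (seq_append ?s ?t) (seq_append (image_seq s) (image_seq t))"
    using assms(1,2) in_D cd by (intro D.eqv_append) (auto simp: represents_def)
  from equivclp_trans[OF equivclp_sym[OF c] this] show ?thesis
    using m(1) m'(1) cd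
    by (simp add: represents_def image_seq_append D.comp_mor D.dom_comp)
qed

text \<open>The path \<open>b\<close>, \<open>F (d i)\<close>, backward line of
  \<open>F (d i)\<close> reduces in two ways: cancelling leaves \<open>b\<close>, composing leaves
  the image of \<open>n\<close> followed by the backward line. The lemma serves both existence and
  uniqueness of the factorization.\<close>

lemma represents_quotient:
  assumes "i \<in> I" "n \<in> N i" "b \<in> Mor D" "Cod D b = FObj F (Dom C (d i))"
    and eq: "FMor F n = FMor F (d i) \<cdot>\<^bsub>D\<^esub> b"
  shows "represents b (Dom C n, [Fwd n, Bwd (d i)])"
proof -
  let ?e = "FMor F (d i)"
  note ci = center_facts[OF assms(1)]
  have e: "?e \<in> Mor D" "Cod D b = Dom D ?e" using assms ci by (auto simp: F_facts)
  have db: "Dom D b = FObj F (Dom C n)"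
    using D.dom_comp[OF assms(3) e] F_facts(3)[of n] ci assms(2) eq by simp
  have in_D: "(Dom D b, [Fwd b, Fwd ?e, Bwd ?e]) \<in> sequences D (FMor F ` d ` I)"
    using assms e ci by (auto simp: sequences_def F_facts dom_obj)
  have c: "D.seq_eqv (Dom D b, [Fwd b, Fwd ?e, Bwd ?e]) (Dom D b, [Fwd b])"
    using D.eqv_inv_right[of ?e "Dom D b" "[Fwd b]" "[]"] in_D assms(1) by simp
  have "D.seq_eqv (Dom D b, [Fwd b, Fwd ?e, Bwd ?e])
      (Dom D b, [Fwd (?e \<cdot>\<^bsub>D\<^esub> b), Bwd ?e])"
    using D.eqv_comp[of "Dom D b" "[]" b ?e "[Bwd ?e]"] in_D by simp
  from equivclp_trans[OF equivclp_sym[OF c] this] show ?thesis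
    using assms(3) eq db by (simp add: represents_def image_seq_def)
qed

lemma quotient_exists:
  assumes "i \<in> I" "n \<in> N i"
  obtains b where "represents b (Dom C n, [Fwd n, Bwd (d i)])"
proof -
  note ci = center_facts[OF assms(1)]
  have n: "n \<in> Mor C" using ci assms by blast
  then have Fn: "FMor F n \<in> Mor D" by (simp add: F_facts)
  \<comment> \<open>Composing with an identity exhibits \<open>FMor F n\<close> itself as a member
    of the sieve generated by the image of \<open>N i\<close>.\<close>
  let ?J = "Ident D (Dom D (FMor F n))"
  have "?J \<in> Mor D" "Cod D ?J = Dom D (FMor F n)"
    using Fn by (simp_all add: D.ident_mor D.cod_ident D.dom_obj)
  then have "FMor F n \<cdot>\<^bsub>D\<^esub> ?J \<in> sieve_gen D (FMor F ` N i)"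
    using assms(2) unfolding sieve_gen_def by blast
  then have "FMor F n \<in> sieve_gen D {FMor F (d i)}"
    using sieves[OF assms(1)] Fn by (auto simp: D.comp_ident)
  then obtain b where "FMor F n = FMor F (d i) \<cdot>\<^bsub>D\<^esub> b" "b \<in> Mor D"
    "Cod D b = Dom D (FMor F (d i))"
    by (auto simp: sieve_gen_def)
  with assms ci show ?thesis
    by (intro that represents_quotient) (auto simp: F_facts)
qed

lemma center_path_Cons_seqs:
  assumes "(X, center_path d ((i, n) # ps) a) \<in> seqs"
  shows "Dom C n = X" "(X, [Fwd n, Bwd (d i)]) \<in> seqs" "(Dom C (d i), center_path d ps a) \<in> seqs"
    "(X, center_path d ((i, n) # ps) a)
      = seq_append (X, [Fwd n, Bwd (d i)]) (Dom C (d i), center_path d ps a)"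
  using assms path_from_start by (auto simp: sequences_def seq_append_def)

text \<open>Induction on the pairs: the sieve hypothesis represents each block of a numerator and a
  backward line by a quotient, \<open>F\<close> represents the final morphism, and representing
  morphisms compose.\<close>

lemma center_path_represented:
  assumes "set ps \<subseteq> pairs" "(X, center_path d ps a) \<in> seqs"
  shows "\<exists>m. represents m (X, center_path d ps a)"
  using assms
proof (induction ps arbitrary: X)
  case Nil
  then show ?case using represents_Fwd[of a] by (auto simp: sequences_def)
next
  case (Cons p ps)
  obtain i n where p: "p = (i, n)" by (cases p)
  note s = center_path_Cons_seqs[OF Cons.prems(2)[unfolded p]]
  have "set ps \<subseteq> pairs" and i: "i \<in> I" "n \<in> N i" using Cons.prems(1) p by auto
  then obtain m where "represents m (Dom C (d i), center_path d ps a)"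
    using Cons.IH s(3) by blast
  moreover obtain b where "represents b (X, [Fwd n, Bwd (d i)])"
    using quotient_exists[OF i] s(1) by blast
  ultimately have "represents (m \<cdot>\<^bsub>D\<^esub> b)
      (seq_append (X, [Fwd n, Bwd (d i)]) (Dom C (d i), center_path d ps a))"
    using s(2,3) by (intro represents_append) simp_all
  then show ?case unfolding p s(4) by blast
qed

section \<open>Construction of the factorization\<close>

definition rep_mor :: "('o, 'm) line_seq set \<Rightarrow> 'n" where
  "rep_mor x = (THE m. \<exists>s\<in>x. represents m s)"

text \<open>A morphism representing some other member of the class also represents \<open>s\<close>,
  by transport along the equivalence, so uniqueness at \<open>s\<close> settles the
  description.\<close>

lemma rep_mor_eq:
  assumes "represents m s" "s \<in> seqs"
  shows "rep_mor (cls s) = m"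
  unfolding rep_mor_def
proof (rule the_equality)
  show "\<exists>t\<in>cls s. represents m t" using assms(1) seq_class_self by blast
next
  fix m' assume "\<exists>t\<in>cls s. represents m' t"
  then obtain t where "s \<simeq> t" "represents m' t" by (auto simp: seq_class_def)
  then have "represents m' s" by (blast intro: represents_eqv[OF _ equivclp_sym])
  then show "m' = m" using assms represents_unique by blast
qed

lemma center_fractionE:
  assumes "x \<in> center_fractions C I N d"
  obtains s where "s \<in> seqs" "x = cls s" "represents (rep_mor x) s"
proof -
  from assms obtain X ps a where x: "x = cls (X, center_path d ps a)" "set ps \<subseteq> pairs"
    "(X, center_path d ps a) \<in> seqs"
    unfolding center_fractions_eq by blast
  obtain m where m: "represents m (X, center_path d ps a)"
    using center_path_represented[OF x(2,3)] by blast
  then show ?thesis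
    using that[OF x(3,1)] rep_mor_eq[OF m x(3)] x(1) by simp
qed

text \<open>The canonical functor is the identity on objects, which forces the object map. The
  restriction makes the morphism map extensional, as \<open>is_functor\<close> demands.\<close>

definition factor :: "('o, ('o, 'm) line_seq set, 'p, 'n) cat_functor" where
  "factor = \<lparr>FObj = FObj F, FMor = restrict rep_mor (center_fractions C I N d)\<rparr>"

lemma rep_mor_Fwd: "a \<in> Mor C \<Longrightarrow> rep_mor (cls (Dom C a, [Fwd a])) = FMor F a"
  using rep_mor_eq represents_Fwd single_in_sequences by blast

lemma is_functor_factor: "is_functor (dilatation C I N d) D factor"
proof -
  let ?L = "localization C (d ` I)"
  have ends: "rep_mor x \<in> Mor D \<and> Dom D (rep_mor x) = FObj F (Dom ?L x) \<and>
      Cod D (rep_mor x) = FObj F (Cod ?L x)" if x: "x \<in> center_fractions C I N d" for x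
  proof -
    obtain s where s: "s \<in> seqs" "x = cls s" "represents (rep_mor x) s"
      using center_fractionE[OF x] .
    then show ?thesis
      using represents_ends[OF s(3,1)] Dom_localization[OF s(1)] Cod_localization[OF s(1)] by simp
  qed
  have comp: "rep_mor (Comp ?L y x) = rep_mor y \<cdot>\<^bsub>D\<^esub> rep_mor x"
    if xy: "x \<in> center_fractions C I N d" "y \<in> center_fractions C I N d" "Cod ?L x = Dom ?L y" for x y
  proof -
    obtain s where s: "s \<in> seqs" "x = cls s" "represents (rep_mor x) s"
      using center_fractionE[OF xy(1)] .
    obtain t where t: "t \<in> seqs" "y = cls t" "represents (rep_mor y) t"
      using center_fractionE[OF xy(2)] .
    have st: "seq_cod C s = fst t"
      using xy(3) s(1,2) t(1,2) by (simp add: Cod_localization Dom_localization)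
    then have "Comp ?L y x = cls (seq_append s t)"
      using s(1,2) t(1,2) by (simp add: Comp_localization)
    then show ?thesis
      using rep_mor_eq[OF represents_append[OF s(3) t(3)] seq_append_in_sequences] s(1) t(1) st
      by simp
  qed
  \<comment> \<open>The empty sequence is traded for the one-line sequence of an identity of
    \<open>C\<close>, on which \<open>rep_mor\<close> agrees with \<open>F\<close>.\<close>
  have ident: "rep_mor (cls (X, [])) = Ident D (FObj F X)" if "X \<in> Obj C" for X
    using rep_mor_Fwd[OF ident_mor[OF that]] cls_ident[OF that] that
    by (simp add: dom_ident F_facts)
  show ?thesis
    using F_functor ends comp ident
    unfolding is_functor_def factor_def
    by (auto simp: category_dilatation empty_in_center_fractions Comp_in_center_fractions)
qed

lemma functor_comp_factor: "functor_comp C factor (dilatation_functor C I d) = F"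
proof -
  have "compose (Obj C) (FObj F) (\<lambda>X\<in>Obj C. X) = FObj F"
    by (rule extensionalityI[OF compose_extensional F_extensional(1)]) (simp add: compose_eq)
  moreover have "compose (Mor C) (restrict rep_mor (center_fractions C I N d))
      (\<lambda>a\<in>Mor C. cls (Dom C a, [Fwd a])) = FMor F"
    by (rule extensionalityI[OF compose_extensional F_extensional(2)])
      (simp add: compose_eq single_in_center_fractions rep_mor_Fwd)
  ultimately show ?thesis
    by (simp add: functor_comp_def factor_def dilatation_functor_def)
qed

section \<open>Uniqueness: an arbitrary factorization \<open>G\<close>\<close>

context
  fixes G :: "('o, ('o, 'm) line_seq set, 'p, 'n) cat_functor"
  assumes G: "is_functor (dilatation C I N d) D G"
    and comp: "functor_comp C G (dilatation_functor C I d) = F"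
begin

lemma G_obj: "X \<in> Obj C \<Longrightarrow> FObj G X = FObj F X"
  by (subst comp[symmetric]) (simp add: functor_comp_def dilatation_functor_def compose_eq)

lemma G_Fwd: "a \<in> Mor C \<Longrightarrow> FMor G (cls (Dom C a, [Fwd a])) = FMor F a"
  by (subst comp[symmetric]) (simp add: functor_comp_def dilatation_functor_def compose_eq)

lemma G_extensional:
  "FObj G \<in> extensional (Obj C)" "FMor G \<in> extensional (center_fractions C I N d)"
  using G by (simp_all add: is_functor_def PiE_def)

lemma G_append:
  assumes "s \<in> seqs" "t \<in> seqs" "seq_cod C s = fst t"
    "cls s \<in> center_fractions C I N d" "cls t \<in> center_fractions C I N d"
  shows "FMor G (cls (seq_append s t)) = FMor G (cls t) \<cdot>\<^bsub>D\<^esub> FMor G (cls s)"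
  using G assms unfolding is_functor_def
  by (simp add: Cod_localization Dom_localization flip: Comp_localization)

lemma quotient_in_center_fractions:
  assumes "i \<in> I" "n \<in> N i"
  shows "cls (Dom C n, [Fwd n, Bwd (d i)]) \<in> center_fractions C I N d"
proof -
  \<comment> \<open>An identity serves as the final morphism of a center path with one pair; it is
    then deleted by the identity relation.\<close>
  let ?J = "Ident C (Dom C (d i))"
  note ci = center_facts[OF assms(1)]
  have s: "(Dom C n, [Fwd n, Bwd (d i), Fwd ?J]) \<in> seqs"
    using assms ci by (auto simp: sequences_def dom_obj ident_mor dom_ident cod_ident)
  then have "cls (Dom C n, [Fwd n, Bwd (d i), Fwd ?J]) = cls (Dom C n, [Fwd n, Bwd (d i)])"
    using eqv_ident[of "Dom C (d i)" "Dom C n" "[Fwd n, Bwd (d i)]" "[]"] ci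
    by (auto intro!: seq_class_eqI simp: dom_obj)
  with s show ?thesis
    using center_fractionsI[of "[(i, n)]" ?J "Dom C n"] assms ci
    by (auto simp: ident_mor dom_obj)
qed

text \<open>Composing the class of \<open>n, l\<^bsub>d i\<^esub>\<close> with the class of \<open>d i\<close> gives the class of \<open>n\<close>, so \<open>G\<close> must
  send the former to a quotient of \<open>F n\<close> by \<open>F (d i)\<close>.\<close>

lemma G_quotient:
  assumes "i \<in> I" "n \<in> N i"
  shows "represents (FMor G (cls (Dom C n, [Fwd n, Bwd (d i)]))) (Dom C n, [Fwd n, Bwd (d i)])"
proof -
  let ?s = "(Dom C n, [Fwd n, Bwd (d i)])" and ?t = "(Dom C (d i), [Fwd (d i)])"
  note ci = center_facts[OF assms(1)] and q = quotient_in_center_fractions[OF assms]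
  have s: "?s \<in> seqs" using assms ci by (auto simp: sequences_def dom_obj)
  have t: "?t \<in> seqs" using ci by (intro single_in_sequences)
  have st: "seq_append ?s ?t \<in> seqs" using s t by (intro seq_append_in_sequences) auto
  then have "cls (seq_append ?s ?t) = cls (Dom C n, [Fwd n])"
    using eqv_inv_left[of "d i" "Dom C n" "[Fwd n]" "[]"] assms
    by (auto intro!: seq_class_eqI simp: seq_append_def)
  then have "FMor F n = FMor F (d i) \<cdot>\<^bsub>D\<^esub> FMor G (cls ?s)"
    using G_append[OF s t] q single_in_center_fractions G_Fwd ci assms(2) by auto
  moreover have "FMor G (cls ?s) \<in> Mor D" "Cod D (FMor G (cls ?s)) = FObj F (Dom C (d i))"
    using G q s ci unfolding is_functor_def
    by (auto simp: Cod_localization G_obj dom_obj)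
  ultimately show ?thesis
    using assms by (intro represents_quotient) auto
qed

text \<open>\<open>G\<close> splits along the blocks of the path and its value on each piece is
  representing. With uniqueness of representing morphisms, this forces \<open>G\<close> to agree
  with \<open>rep_mor\<close>.\<close>

lemma G_represents:
  assumes "set ps \<subseteq> pairs" "a \<in> Mor C" "(X, center_path d ps a) \<in> seqs"
  shows "represents (FMor G (cls (X, center_path d ps a))) (X, center_path d ps a)"
  using assms
proof (induction ps arbitrary: X)
  case Nil
  then show ?case using represents_Fwd[of a] G_Fwd[of a] by (auto simp: sequences_def)
next
  case (Cons p ps)
  obtain i n where p: "p = (i, n)" by (cases p)
  then have i: "i \<in> I" "n \<in> N i" using Cons.prems by auto
  note s = center_path_Cons_seqs[OF Cons.prems(3)[unfolded p]]
  have "cls (Dom C (d i), center_path d ps a) \<in> center_fractions C I N d"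
    using Cons.prems s(3) by (intro center_fractionsI) auto
  moreover have "represents (FMor G (cls (Dom C (d i), center_path d ps a)))
      (Dom C (d i), center_path d ps a)"
    using Cons s(3) by auto
  ultimately show ?case
    unfolding p s(4)
    using G_quotient[OF i] quotient_in_center_fractions[OF i] s(1-3)
    by (subst G_append) (auto intro!: represents_append)
qed

text \<open>Both functors are extensional, so agreement on objects of \<open>C\<close> and on center
  fractions already gives equality of the records.\<close>

lemma factor_unique: "G = factor"
proof -
  have "FObj G = FObj F"
    by (rule extensionalityI[OF G_extensional(1) F_extensional(1)]) (rule G_obj)
  moreover have "FMor G = restrict rep_mor (center_fractions C I N d)"
  proof (rule extensionalityI[OF G_extensional(2) restrict_extensional])
    fix x assume x: "x \<in> center_fractions C I N d"
    then have "FMor G x = rep_mor x"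
      using rep_mor_eq[OF G_represents] unfolding center_fractions_eq by auto
    with x show "FMor G x = restrict rep_mor (center_fractions C I N d) x" by simp
  qed
  ultimately show ?thesis
    by (simp add: factor_def)
qed

end

end

theorem theorem3p10:
  fixes C :: "('o, 'm) cat" and D :: "('p, 'n) cat"
    and I :: "'i set" and N :: "'i \<Rightarrow> 'm set" and d :: "'i \<Rightarrow> 'm"
    and F :: "('o, 'm, 'p, 'n) cat_functor"
  assumes "category C"
    and "center C I N d"
    and "regular_functor C (d ` I) D F"
    and "\<And>i. i \<in> I \<Longrightarrow> sieve_gen D (FMor F ` N i) \<subseteq> sieve_gen D {FMor F (d i)}"
  shows "\<exists>!F'. is_functor (dilatation C I N d) D F' \<and>
    functor_comp C F' (dilatation_functor C I d) = F"
proof -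
  interpret regular_dilatation C I N d D F
    using assms
    by (simp add: regular_dilatation_def regular_dilatation_axioms_def centered_def
        centered_axioms_def)
  show ?thesis
    using is_functor_factor functor_comp_factor factor_unique by blast
qed

end
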